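(* If $G$ is a graph with girth $5$ and $\mathrm{mz}(G)\leq 3$, then $G$ is a $5$-cycle together with a (possibly empty) set of isolated vertices; that is, $G$ is the disjoint union of $C_5$ and some number $r\geq 0$ of isolated vertices.
   Context: All graphs are finite and simple. The girth of a graph is the length of a shortest cycle contained in the graph. Zero forcing: each vertex of a graph $G$ is blue or white. Color change rule: if $x$ is a blue vertex and $y$ is the only white neighbor of $x$, then $y$ turns blue. A set $B\subseteq V(G)$ is a zero forcing set if, starting with exactly the vertices of $B$ blue, all vertices of $G$ can be made blue by repeated applications of the rule. The zero forcing number $Z(G)$ is the minimum cardinality of a zero forcing set of $G$, and $\mathrm{mz}(G)=|V(G)|-Z(G)$. *)

theory Defs
  imports "Graph_Theory.Graph_Theory" "HOL-Library.Extended_Nat"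
begin

text \<open>
  Finite simple graphs are the loop-free symmetric digraphs of the locale \<^locale>\<open>pair_graph\<close>:
  an edge \<open>{u, v}\<close> is represented by the two arcs \<open>(u, v)\<close> and \<open>(v, u)\<close>.
\<close>

text \<open>
  In this representation \<open>[(u, v), (v, u)]\<close> is a cycle in the sense of \<open>pre_digraph.cycle\<close>.
  The closed walks excluded by the length bound are exactly these; those of length at least 3
  without repeated vertices are the cycles of the undirected graph.
\<close>

definition undirected_cycle :: "'a pair_pre_digraph \<Rightarrow> ('a \<times> 'a) awalk \<Rightarrow> bool" where
  "undirected_cycle G p \<longleftrightarrow> pre_digraph.cycle (with_proj G) p \<and> 3 \<le> length p"

text \<open>The girth of an acyclic graph is \<open>\<infinity>\<close>.\<close>

definition girth :: "'a pair_pre_digraph \<Rightarrow> enat" where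
  "girth G = (INF p \<in> {p. undirected_cycle G p}. enat (length p))"

text \<open>A colouring is given by its set \<open>B\<close> of blue vertices; one step turns one vertex blue.\<close>

definition color_change :: "'a pair_pre_digraph \<Rightarrow> 'a set \<Rightarrow> 'a set \<Rightarrow> bool" where
  "color_change G B B' \<longleftrightarrow>
     (\<exists>x y. x \<in> B \<and> {z. (x, z) \<in> parcs G \<and> z \<notin> B} = {y} \<and> B' = insert y B)"

definition zero_forcing_set :: "'a pair_pre_digraph \<Rightarrow> 'a set \<Rightarrow> bool" where
  "zero_forcing_set G B \<longleftrightarrow> B \<subseteq> pverts G \<and> (color_change G)\<^sup>*\<^sup>* B (pverts G)"

definition zero_forcing_number :: "'a pair_pre_digraph \<Rightarrow> nat" where
  "zero_forcing_number G = (LEAST k. \<exists>B. zero_forcing_set G B \<and> card B = k)"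

lemma zero_forcing_number_le_card: "zero_forcing_number G \<le> card (pverts G)"
  unfolding zero_forcing_number_def zero_forcing_set_def by (rule Least_le) blast

text \<open>By the preceding lemma the subtraction is never truncated.\<close>

definition mz :: "'a pair_pre_digraph \<Rightarrow> nat" where
  "mz G = card (pverts G) - zero_forcing_number G"

text \<open>The cycle on \<open>n\<close> vertices; meaningful only for \<open>n \<ge> 3\<close>.\<close>

definition cycle_graph :: "nat \<Rightarrow> nat pair_pre_digraph" where
  "cycle_graph n = \<lparr> pverts = {..<n},
     parcs = {(i, j). i < n \<and> j < n \<and> (j = Suc i mod n \<or> i = Suc j mod n)} \<rparr>"

definition isolated_vertices :: "nat \<Rightarrow> nat pair_pre_digraph" where
  "isolated_vertices r = \<lparr> pverts = {..<r}, parcs = {} \<rparr>"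

definition disjoint_union_graph ::
  "'a pair_pre_digraph \<Rightarrow> 'b pair_pre_digraph \<Rightarrow> ('a + 'b) pair_pre_digraph" where
  "disjoint_union_graph G H = \<lparr> pverts = pverts G <+> pverts H,
     parcs = map_prod Inl Inl ` parcs G \<union> map_prod Inr Inr ` parcs H \<rparr>"

end

theory Submission
  imports Defs
begin

text \<open>
  Girth 5 excludes triangles and 4-cycles, so a 5-cycle \<open>a, b, c, d, e\<close> of \<open>G\<close> is induced and a
  vertex \<open>y\<close> outside it has at most one neighbour on it. If \<open>y\<close> is adjacent to \<open>a\<close>, the forces
  \<open>y \<rightarrow> a \<rightarrow> b \<rightarrow> c \<rightarrow> d\<close> are possible once all vertices but \<open>a, b, c, d\<close> are blue. If the 5-cycle is
  a component and there is a further edge \<open>uv\<close>, the forces \<open>u \<rightarrow> v\<close>, \<open>a \<rightarrow> e\<close>, \<open>b \<rightarrow> c\<close>, \<open>e \<rightarrow> d\<close> are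
  possible. In both cases \<open>mz G \<ge> 4\<close>.
\<close>

text \<open>The forces are performed in list order, starting with exactly the vertices \<open>y\<close> of the list white.\<close>

fun forcing_chain :: "'a pair_pre_digraph \<Rightarrow> ('a \<times> 'a) list \<Rightarrow> bool" where
  "forcing_chain G [] \<longleftrightarrow> True"
| "forcing_chain G ((x, y) # ps) \<longleftrightarrow> (x, y) \<in> parcs G \<and> x \<notin> insert y (snd ` set ps) \<and>
     y \<notin> snd ` set ps \<and> (\<forall>z \<in> snd ` set ps. (x, z) \<notin> parcs G) \<and> forcing_chain G ps"

lemma distinct_forcing_chain: "forcing_chain G ps \<Longrightarrow> distinct (map snd ps)"
  by (induction G ps rule: forcing_chain.induct) auto

text \<open>Reduces isomorphism to a vertex map: arcs are pairs of vertices, so \<open>f\<close>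
  determines the arc map \<open>map_prod f f\<close>, whose injectivity is inherited from
  \<open>f\<close>.\<close>

lemma digraph_iso_with_projI:
  assumes "pair_wf_digraph G" and inj: "inj_on f (pverts G)"
    and "pverts H = f ` pverts G" and "parcs H = map_prod f f ` parcs G"
  shows "digraph_iso (with_proj G) (with_proj H)"
proof -
  interpret pair_wf_digraph G by fact
  define h :: "('a, 'a \<times> 'a, 'b, 'b \<times> 'b) digraph_isomorphism" where
    "h = \<lparr> iso_verts = f, iso_arcs = map_prod f f, iso_head = snd, iso_tail = fst \<rparr>"
  have "inj_on (map_prod f f) (parcs G)"
    by (rule inj_on_subset[OF map_prod_inj_on[OF inj inj]]) (auto dest: in_arcsD1 in_arcsD2)
  then have "digraph_isomorphism h"
    using inj wf_digraph unfolding digraph_isomorphism_def h_def by simp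
  moreover have "with_proj H = app_iso h (with_proj G)"
    using assms by (simp add: app_iso_def h_def with_proj_def)
  ultimately show ?thesis
    unfolding digraph_iso_def by blast
qed

context pair_graph
begin

lemma parcs_sym: "(u, v) \<in> parcs G \<Longrightarrow> (v, u) \<in> parcs G"
  using pair_sym_arcs by (auto simp: symmetric_def dest: symD)

lemma parcs_commute: "(u, v) \<in> parcs G \<longleftrightarrow> (v, u) \<in> parcs G"
  using parcs_sym by blast

lemma parcs_irrefl: "(u, u) \<notin> parcs G"
  using pair_no_loops by fastforce

text \<open>The chain conditions make \<open>x\<close> blue and \<open>y\<close> its only white
  neighbor; once \<open>y\<close> is blue, the white vertices are exactly the targets in
  \<open>ps\<close>.\<close>

lemma forcing_chain_forces:
  "forcing_chain G ps \<Longrightarrow> (color_change G)\<^sup>*\<^sup>* (pverts G - snd ` set ps) (pverts G)"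
proof (induction ps)
  case Nil
  then show ?case by simp
next
  case (Cons p ps)
  obtain x y where p: "p = (x, y)" by fastforce
  have "color_change G (pverts G - snd ` set (p # ps)) (pverts G - snd ` set ps)"
    unfolding color_change_def using Cons.prems
    by (intro exI[of _ x] exI[of _ y]) (auto simp: p dest: in_arcsD1 in_arcsD2)
  then show ?case
    using Cons by (auto simp: p intro: converse_rtranclp_into_rtranclp)
qed

text \<open>The targets are distinct vertices and their complement is a zero forcing set. This turns
  each explicit chain into a lower bound for \<open>mz\<close>.\<close>

lemma length_forcing_chain_le_mz:
  assumes "forcing_chain G ps"
  shows "length ps \<le> mz G"
proof -
  let ?W = "snd ` set ps"
  have "set ps \<subseteq> parcs G"
    using assms by (induction G ps rule: forcing_chain.induct) auto
  then have W: "?W \<subseteq> pverts G"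
    using arc_snd_in_verts by blast
  have card_W: "card ?W = length ps"
    using distinct_card[OF distinct_forcing_chain[OF assms]] by simp
  have "zero_forcing_set G (pverts G - ?W)"
    unfolding zero_forcing_set_def using forcing_chain_forces[OF assms] by blast
  then have "zero_forcing_number G \<le> card (pverts G - ?W)"
    unfolding zero_forcing_number_def by (intro Least_le) blast
  also have "\<dots> = card (pverts G) - length ps"
    using W card_W by (simp add: card_Diff_subset)
  finally show ?thesis
    using card_mono[OF pair_finite_verts W] card_W unfolding mz_def by linarith
qed

lemma undirected_cycle_iff:
  "undirected_cycle G p \<longleftrightarrow>
     (\<exists>u. u \<in> pverts G \<and> set p \<subseteq> parcs G \<and> pcas u p u \<and> distinct (tl (pawalk_verts u p))) \<and>
     3 \<le> length p"
  unfolding undirected_cycle_def cycle_def awalk_def by auto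

lemma girth_le: "undirected_cycle G p \<Longrightarrow> girth G \<le> enat (length p)"
  unfolding girth_def by (intro INF_lower) simp

text \<open>A third arc would close a cycle of length 3; its vertices are distinct because there are
  no loops.\<close>

lemma no_triangle:
  assumes "3 < girth G" "(u, v) \<in> parcs G" "(v, w) \<in> parcs G"
  shows "(u, w) \<notin> parcs G"
proof
  assume "(u, w) \<in> parcs G"
  with assms have "undirected_cycle G [(u, v), (v, w), (w, u)]"
    by (auto simp: undirected_cycle_iff parcs_irrefl parcs_commute dest: in_arcsD1)
  from girth_le[OF this] assms(1) show False
    by (simp add: numeral_eq_enat eval_nat_numeral)
qed

text \<open>Adjacent vertices differ automatically; distinctness of the opposite pairs rules out
  degenerate closed walks such as \<open>u, v, u, x\<close>.\<close>

lemma no_square: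
  assumes "4 < girth G" "(u, v) \<in> parcs G" "(v, w) \<in> parcs G" "(w, x) \<in> parcs G"
    and "u \<noteq> w" "v \<noteq> x"
  shows "(u, x) \<notin> parcs G"
proof
  assume "(u, x) \<in> parcs G"
  with assms have "undirected_cycle G [(u, v), (v, w), (w, x), (x, u)]"
    by (auto simp: undirected_cycle_iff parcs_irrefl parcs_commute dest: in_arcsD1)
  from girth_le[OF this] assms(1) show False
    by (simp add: numeral_eq_enat eval_nat_numeral)
qed

text \<open>One orientation per edge suffices, by symmetry. Absence of chords is not built in but
  derived from the girth.\<close>

definition pentagon :: "'a \<Rightarrow> 'a \<Rightarrow> 'a \<Rightarrow> 'a \<Rightarrow> 'a \<Rightarrow> bool" where
  "pentagon a b c d e \<longleftrightarrow> distinct [a, b, c, d, e] \<and>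
     {(a, b), (b, c), (c, d), (d, e), (e, a)} \<subseteq> parcs G"

lemma pentagon_rotate:
  assumes "pentagon a b c d e"
  shows "pentagon b c d e a" "pentagon c d e a b" "pentagon d e a b c" "pentagon e a b c d"
  using assms unfolding pentagon_def by auto

lemma pentagon_chord:
  assumes "3 < girth G" "pentagon a b c d e"
  shows "(a, c) \<notin> parcs G"
  using no_triangle[OF assms(1), of a b c] assms(2) by (auto simp: pentagon_def)

lemma pentagon_chords:
  assumes "3 < girth G" "pentagon a b c d e"
  shows "(a, c) \<notin> parcs G" "(b, d) \<notin> parcs G" "(c, e) \<notin> parcs G" "(d, a) \<notin> parcs G"
    "(e, b) \<notin> parcs G" "(c, a) \<notin> parcs G" "(d, b) \<notin> parcs G" "(e, c) \<notin> parcs G" "(a, d) \<notin> parcs G"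
    "(b, e) \<notin> parcs G"
  using pentagon_chord[OF assms(1)] assms(2) pentagon_rotate[OF assms(2)] parcs_sym by blast+

lemma girth_5_imp_pentagon:
  assumes "girth G = 5"
  shows "\<exists>a b c d e. pentagon a b c d e"
proof -
  let ?L = "(\<lambda>p. enat (length p)) ` {p. undirected_cycle G p}"
  \<comment> \<open>The infimum of the empty set is \<infinity>, so girth 5 forces a cycle to
    exist.\<close>
  have "?L \<noteq> {}"
  proof
    assume "?L = {}"
    then have "girth G = \<infinity>"
      unfolding girth_def by (metis Inf_empty top_enat_def)
    with assms show False by simp
  qed
  then obtain k where "k \<in> ?L" by blast
  \<comment> \<open>\<open>enat\<close> is well-ordered, so the infimum is attained by a cycle of
    length exactly 5.\<close>
  then have "girth G \<in> ?L"
    unfolding girth_def by (rule wellorder_InfI)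
  then obtain p where p: "undirected_cycle G p" "length p = 5"
    using assms by (auto simp: numeral_eq_enat)
  then obtain u where u: "set p \<subseteq> parcs G" "pcas u p u" "distinct (tl (pawalk_verts u p))"
    by (auto simp: undirected_cycle_iff)
  from p(2) obtain e1 e2 e3 e4 e5 where "p = [e1, e2, e3, e4, e5]"
    by (auto simp: numeral_eq_Suc length_Suc_conv)
  \<comment> \<open>Each head is the tail of the cyclically next arc, so distinctness of the heads
    passes to the tails.\<close>
  with u have "pentagon (fst e1) (fst e2) (fst e3) (fst e4) (fst e5)"
    unfolding pentagon_def by (cases e1; cases e2; cases e3; cases e4; cases e5) auto
  then show ?thesis by blast
qed

lemma pentagon_pendant:
  assumes girth: "4 < girth G" and P: "pentagon a b c d e"
    and y: "(y, a) \<in> parcs G" "y \<notin> {b, c, d, e}"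
  shows "4 \<le> mz G"
proof -
  have "3 < girth G"
    using girth by (rule order.strict_trans[rotated]) simp
  note no_triangle = no_triangle[OF this] and no_square = no_square[OF girth]
    and chords = pentagon_chords[OF this P]
  have "(y, b) \<notin> parcs G"
    using no_triangle[of y a b] P y by (auto simp: pentagon_def)
  moreover have "(y, c) \<notin> parcs G"
    using no_square[of y a b c] P y by (auto simp: pentagon_def)
  moreover have "(y, d) \<notin> parcs G"
    using no_square[of y a e d] P y by (auto simp: pentagon_def parcs_commute)
  \<comment> \<open>\<open>e\<close> starts blue, so it does not obstruct the forces of
    \<open>y\<close> and \<open>a\<close>.\<close>
  ultimately have "forcing_chain G [(y, a), (a, b), (b, c), (c, d)]"
    using P y chords by (auto simp: pentagon_def parcs_irrefl parcs_commute)
  from length_forcing_chain_le_mz[OF this] show ?thesis by simp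
qed

lemma pentagon_disjoint_edge:
  assumes girth: "3 < girth G" and P: "pentagon a b c d e"
    and uv: "(u, v) \<in> parcs G" "u \<notin> {a, b, c, d, e}" "v \<notin> {a, b, c, d, e}"
    and u: "\<forall>x \<in> {a, b, c, d, e}. (u, x) \<notin> parcs G"
  shows "4 \<le> mz G"
proof -
  \<comment> \<open>Forcing \<open>v\<close> first keeps edges between \<open>v\<close> and the
    pentagon from blocking the later forces.\<close>
  have "forcing_chain G [(u, v), (a, e), (b, c), (e, d)]"
    using P uv u pentagon_chords[OF girth P] by (auto simp: pentagon_def parcs_irrefl parcs_commute)
  from length_forcing_chain_le_mz[OF this] show ?thesis by simp
qed

lemma mz_le_3_imp_parcs_pentagon:
  assumes girth: "4 < girth G" and P: "pentagon a b c d e" and mz: "mz G \<le> 3"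
  shows "parcs G = {(a, b), (b, a), (b, c), (c, b), (c, d), (d, c), (d, e), (e, d), (e, a), (a, e)}"
    (is "_ = ?A")
proof
  have girth': "3 < girth G"
    using girth by (rule order.strict_trans[rotated]) simp
  note pendant = pentagon_pendant[OF girth]
  \<comment> \<open>Rotating the pentagon brings any \<open>x\<close> on it into the position of
    \<open>a\<close>.\<close>
  have nbr: "y \<in> {a, b, c, d, e}" if "(y, x) \<in> parcs G" "x \<in> {a, b, c, d, e}" for x y
    using that mz pendant[OF P, of y] pentagon_rotate[OF P, THEN pendant, of y] by force
  have inside: "u \<in> {a, b, c, d, e}" if "(u, v) \<in> parcs G" for u v
  proof (rule ccontr)
    assume u: "u \<notin> {a, b, c, d, e}"
    then have "v \<notin> {a, b, c, d, e}" and "\<forall>x \<in> {a, b, c, d, e}. (u, x) \<notin> parcs G"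
      using nbr \<open>(u, v) \<in> parcs G\<close> by blast+
    then have "4 \<le> mz G"
      using pentagon_disjoint_edge[OF girth' P \<open>(u, v) \<in> parcs G\<close> u] by blast
    with mz show False by simp
  qed
  show "parcs G \<subseteq> ?A"
  proof (rule subrelI)
    fix u v assume uv: "(u, v) \<in> parcs G"
    have "u \<in> {a, b, c, d, e}" "v \<in> {a, b, c, d, e}"
      using inside uv parcs_sym by blast+
    \<comment> \<open>Of the 25 ordered pairs, 5 are loops and 10 are chords; the other 10 form
      \<open>?A\<close>.\<close>
    with uv show "(u, v) \<in> ?A"
      by (elim insertE emptyE) (simp_all add: parcs_irrefl pentagon_chords[OF girth' P])
  qed
  show "?A \<subseteq> parcs G"
    using P by (auto simp: pentagon_def parcs_commute)
qed

end

lemma parcs_cycle_graph_5: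
  "parcs (cycle_graph 5) =
     {(0, 1), (1, 0), (1, 2), (2, 1), (2, 3), (3, 2), (3, 4), (4, 3), (4, 0), (0, 4)}"
proof -
  have "parcs (cycle_graph 5) = (\<Union>i \<in> {..<5}. {(i, Suc i mod 5), (Suc i mod 5, i)})"
    unfolding cycle_graph_def by auto
  also have "{..<5} = {0, 1, 2, 3, 4 :: nat}" by auto
  finally show ?thesis
    by (simp add: numeral_2_eq_2) blast
qed

theorem proposition10:
  fixes G :: "'a pair_pre_digraph"
  assumes "pair_graph G"
    and "girth G = 5"
    and "mz G \<le> 3"
  shows "\<exists>r :: nat. digraph_iso (with_proj G)
           (with_proj (disjoint_union_graph (cycle_graph 5) (isolated_vertices r)))"
proof -
  interpret pair_graph G by fact
  obtain a b c d e where P: "pentagon a b c d e"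
    using girth_5_imp_pentagon assms(2) by blast
  let ?C = "{a, b, c, d, e}"
  have parcs: "parcs G =
      {(a, b), (b, a), (b, c), (c, b), (c, d), (d, c), (d, e), (e, d), (e, a), (a, e)}"
    using mz_le_3_imp_parcs_pentagon P assms by simp
  have C: "?C \<subseteq> pverts G"
    using P by (auto simp: pentagon_def dest: in_arcsD1)
  define r where "r = card (pverts G - ?C)"
  obtain h where h: "bij_betw h (pverts G - ?C) {..<r}"
    using ex_bij_betw_finite_nat[of "pverts G - ?C"] pair_finite_verts
    unfolding r_def atLeast0LessThan by auto
  \<comment> \<open>The pentagon goes to the left summand in cyclic order; \<open>h\<close> numbers
    the remaining vertices, which go to the right one.\<close>
  define f :: "'a \<Rightarrow> nat + nat" where
    "f = (\<lambda>v. Inr (h v))(a := Inl 0, b := Inl 1, c := Inl 2, d := Inl 3, e := Inl 4)"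
  have f_C: "f a = Inl 0" "f b = Inl 1" "f c = Inl 2" "f d = Inl 3" "f e = Inl 4"
    using P by (auto simp: f_def pentagon_def)
  have f_rest: "f v = Inr (h v)" if "v \<in> pverts G - ?C" for v
    using that by (simp add: f_def)
  have inj_C: "inj_on f ?C"
    by (simp add: inj_on_def f_C)
  have inj_rest: "inj_on f (pverts G - ?C)"
    using bij_betw_imp_inj_on[OF h] f_rest unfolding inj_on_def by (metis Inr_inject)
  have "{..<5} = {0, 1, 2, 3, 4 :: nat}" by auto
  then have img_C: "f ` ?C = Inl ` {..<5}"
    by (simp add: f_C)
  have "f ` (pverts G - ?C) = Inr ` h ` (pverts G - ?C)"
    unfolding image_image by (rule image_cong) (simp_all add: f_rest)
  then have img_rest: "f ` (pverts G - ?C) = Inr ` {..<r}"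
    using bij_betw_imp_surj_on[OF h] by simp
  have V: "pverts G = ?C \<union> (pverts G - ?C)"
    using C by blast
  \<comment> \<open>The set differences match \<open>inj_on_Un\<close>; the images are disjoint
    because they lie in different summands.\<close>
  have "f ` (?C - (pverts G - ?C)) \<inter> f ` ((pverts G - ?C) - ?C) \<subseteq> f ` ?C \<inter> f ` (pverts G - ?C)"
    by blast
  also have "\<dots> = {}"
    unfolding img_C img_rest by blast
  finally have "inj_on f (?C \<union> (pverts G - ?C))"
    unfolding inj_on_Un using inj_C inj_rest by blast
  then have inj: "inj_on f (pverts G)"
    using V by simp
  have verts: "f ` pverts G = {..<5} <+> {..<r}"
    unfolding Plus_def img_C[symmetric] img_rest[symmetric] image_Un[symmetric] using V by simp
  have "digraph_iso (with_proj G)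
      (with_proj (disjoint_union_graph (cycle_graph 5) (isolated_vertices r)))"
  proof (rule digraph_iso_with_projI[OF pair_wf_digraph_axioms inj])
    let ?H = "disjoint_union_graph (cycle_graph 5) (isolated_vertices r)"
    show "pverts ?H = f ` pverts G"
      by (simp add: verts disjoint_union_graph_def cycle_graph_def isolated_vertices_def)
    show "parcs ?H = map_prod f f ` parcs G"
      by (simp add: disjoint_union_graph_def isolated_vertices_def parcs_cycle_graph_5 parcs f_C)
  qed
  then show ?thesis ..
qed

end
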